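(* Let $n\ge 3$ and let $\Gamma_\Omega$ be the non-commuting graph on $D_{2n}$, where $\Omega=\Omega_1\cup\Omega_2$ with $\Omega_1=\{r^i : 1\le i\le n\}-Z(D_{2n})$ and $\Omega_2=\{sr^i : 1\le i\le n\}$. Then the detour polynomial of $\Gamma_\Omega$ is $$D(\Gamma_\Omega,x)=\begin{cases}(n-1)(2n-1)x^{2n-2}, & \text{if } n \text{ is odd};\\ (n-1)(2n-3)x^{2n-3}, & \text{if } n \text{ is even}.\end{cases}$$
   Context: $D_{2n}=\langle r,s : r^n=s^2=1,\ srs=r^{-1}\rangle$ is the dihedral group of order $2n$, and $Z(D_{2n})$ is its center; note $\Omega=D_{2n}-Z(D_{2n})$. $\Gamma_\Omega$ is the simple undirected graph with vertex set $\Omega$ in which two distinct vertices $x,y$ are adjacent if and only if $xy\neq yx$. For distinct vertices $u,v$ of a graph $\Gamma$, the detour distance $D(u,v)$ is the length (number of edges) of a longest $u$–$v$ path in $\Gamma$, where a path is a walk with no repeated vertices. The detour polynomial (called the detour index polynomial) is $D(\Gamma,x)=\sum_{\{u,v\}} x^{D(u,v)}$, the sum running over all unordered pairs of distinct vertices of $\Gamma$. *)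

theory Defs
  imports
    "HOL-Algebra.Group"
    "HOL-Computational_Algebra.Polynomial"
    "Graph_Theory.Pair_Digraph"
begin

section \<open>Groups given by generators and relations\<close>

text \<open>
  A letter \<open>(g, False)\<close> stands for the generator \<open>g\<close> and \<open>(g, True)\<close> for its formal inverse.
  A pair \<open>(u, v)\<close> in a set of relations stands for the defining relation \<open>u = v\<close>.
\<close>

type_synonym 'g word = "('g \<times> bool) list"

inductive word_eq :: "('g word \<times> 'g word) set \<Rightarrow> 'g word \<Rightarrow> 'g word \<Rightarrow> bool"
  for R where
  rel: "(u, v) \<in> R \<Longrightarrow> word_eq R u v"
| cancel: "word_eq R [(g, b), (g, \<not> b)] []"
| refl: "word_eq R u u"
| sym: "word_eq R u v \<Longrightarrow> word_eq R v u"
| trans: "word_eq R u v \<Longrightarrow> word_eq R v w \<Longrightarrow> word_eq R u w"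
| cong: "word_eq R u u' \<Longrightarrow> word_eq R v v' \<Longrightarrow> word_eq R (u @ v) (u' @ v')"

definition word_class :: "('g word \<times> 'g word) set \<Rightarrow> 'g word \<Rightarrow> 'g word set" where
  "word_class R w = {v. word_eq R w v}"

definition presented_group :: "('g word \<times> 'g word) set \<Rightarrow> 'g word set monoid" where
  "presented_group R =
    \<lparr> carrier = range (word_class R),
      monoid.mult = (\<lambda>A B. \<Union>a\<in>A. \<Union>b\<in>B. word_class R (a @ b)),
      monoid.one = word_class R [] \<rparr>"

lemma word_class_eq_iff: "word_class R u = word_class R v \<longleftrightarrow> word_eq R u v"
proof
  assume "word_class R u = word_class R v"
  moreover have "v \<in> word_class R v"
    by (simp add: word_class_def word_eq.refl)
  ultimately have "v \<in> word_class R u"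
    by (simp only:)
  then show "word_eq R u v"
    by (simp add: word_class_def)
next
  assume "word_eq R u v"
  then show "word_class R u = word_class R v"
    unfolding word_class_def
    by (intro Collect_cong iffI) (erule word_eq.trans[OF word_eq.sym], assumption,
      erule word_eq.trans, assumption)
qed

lemma presented_group_mult:
  "word_class R u \<otimes>\<^bsub>presented_group R\<^esub> word_class R v = word_class R (u @ v)"
proof -
  have "word_class R (a @ b) = word_class R (u @ v)"
    if "a \<in> word_class R u" "b \<in> word_class R v" for a b
  proof -
    from that have "word_eq R u a" "word_eq R v b"
      by (simp_all add: word_class_def)
    then have "word_eq R (u @ v) (a @ b)"
      by (rule word_eq.cong)
    then show ?thesis
      unfolding word_class_eq_iff by (rule word_eq.sym)
  qed
  moreover have "u \<in> word_class R u" "v \<in> word_class R v"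
    by (simp_all add: word_class_def word_eq.refl)
  ultimately have "(\<Union>a\<in>word_class R u. \<Union>b\<in>word_class R v. word_class R (a @ b))
      = word_class R (u @ v)"
    by blast
  then show ?thesis
    by (simp add: presented_group_def)
qed

lemma word_eq_inverse:
  "word_eq R (map (\<lambda>(g, b). (g, \<not> b)) (rev w) @ w) []"
proof (induction w)
  case Nil
  show ?case by (simp add: word_eq.refl)
next
  case (Cons x w)
  obtain g b where x: "x = (g, b)" by force
  let ?i = "map (\<lambda>(g, b). (g, \<not> b)) (rev w)"
  have "word_eq R ([(g, \<not> b), (g, b)] @ w) ([] @ w)"
    using word_eq.cancel[of R g "\<not> b"] by (intro word_eq.cong word_eq.refl) simp
  then have "word_eq R (?i @ ([(g, \<not> b), (g, b)] @ w)) (?i @ w)"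
    by (intro word_eq.cong word_eq.refl) simp
  then have "word_eq R (?i @ ([(g, \<not> b), (g, b)] @ w)) []"
    using Cons.IH by (rule word_eq.trans)
  then show ?case
    by (simp add: x)
qed

lemma group_presented_group: "group (presented_group R)"
proof (rule groupI)
  have carrier: "carrier (presented_group R) = range (word_class R)"
    and one: "\<one>\<^bsub>presented_group R\<^esub> = word_class R []"
    by (simp_all add: presented_group_def)
  show "\<one>\<^bsub>presented_group R\<^esub> \<in> carrier (presented_group R)"
    by (simp add: carrier one)
  fix x assume "x \<in> carrier (presented_group R)"
  then obtain u where x: "x = word_class R u" by (auto simp: carrier)
  show "\<one>\<^bsub>presented_group R\<^esub> \<otimes>\<^bsub>presented_group R\<^esub> x = x"
    by (simp add: x one presented_group_mult)
  show "\<exists>y\<in>carrier (presented_group R). y \<otimes>\<^bsub>presented_group R\<^esub> x = \<one>\<^bsub>presented_group R\<^esub>"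
  proof
    let ?y = "word_class R (map (\<lambda>(g, b). (g, \<not> b)) (rev u))"
    show "?y \<in> carrier (presented_group R)"
      unfolding carrier by (rule rangeI)
    show "?y \<otimes>\<^bsub>presented_group R\<^esub> x = \<one>\<^bsub>presented_group R\<^esub>"
      unfolding x one presented_group_mult word_class_eq_iff by (rule word_eq_inverse)
  qed
  fix y assume "y \<in> carrier (presented_group R)"
  then obtain v where y: "y = word_class R v" by (auto simp: carrier)
  show "x \<otimes>\<^bsub>presented_group R\<^esub> y \<in> carrier (presented_group R)"
    by (simp add: x y carrier presented_group_mult)
  fix z assume "z \<in> carrier (presented_group R)"
  then obtain w where z: "z = word_class R w" by (auto simp: carrier)
  show "x \<otimes>\<^bsub>presented_group R\<^esub> y \<otimes>\<^bsub>presented_group R\<^esub> z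
      = x \<otimes>\<^bsub>presented_group R\<^esub> (y \<otimes>\<^bsub>presented_group R\<^esub> z)"
    by (simp add: x y z presented_group_mult)
qed


section \<open>The dihedral group\<close>

datatype dihedral_gen = Gen_r | Gen_s

definition dihedral_relations :: "nat \<Rightarrow> (dihedral_gen word \<times> dihedral_gen word) set" where
  "dihedral_relations n =
    {(replicate n (Gen_r, False), []),
     ([(Gen_s, False), (Gen_s, False)], []),
     ([(Gen_s, False), (Gen_r, False), (Gen_s, False)], [(Gen_r, True)])}"

definition dihedral_group :: "nat \<Rightarrow> dihedral_gen word set monoid" where
  "dihedral_group n = presented_group (dihedral_relations n)"

definition dihedral_r :: "nat \<Rightarrow> dihedral_gen word set" where
  "dihedral_r n = word_class (dihedral_relations n) [(Gen_r, False)]"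

definition dihedral_s :: "nat \<Rightarrow> dihedral_gen word set" where
  "dihedral_s n = word_class (dihedral_relations n) [(Gen_s, False)]"

definition group_center :: "('a, 'b) monoid_scheme \<Rightarrow> 'a set" where
  "group_center G =
    {z \<in> carrier G. \<forall>x\<in>carrier G. z \<otimes>\<^bsub>G\<^esub> x = x \<otimes>\<^bsub>G\<^esub> z}"

definition dihedral_Omega :: "nat \<Rightarrow> dihedral_gen word set set" where
  "dihedral_Omega n = carrier (dihedral_group n) - group_center (dihedral_group n)"

definition dihedral_Omega1 :: "nat \<Rightarrow> dihedral_gen word set set" where
  "dihedral_Omega1 n =
    {dihedral_r n [^]\<^bsub>dihedral_group n\<^esub> i | i::nat. 1 \<le> i \<and> i \<le> n}
      - group_center (dihedral_group n)"

definition dihedral_Omega2 :: "nat \<Rightarrow> dihedral_gen word set set" where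
  "dihedral_Omega2 n =
    {dihedral_s n \<otimes>\<^bsub>dihedral_group n\<^esub> (dihedral_r n [^]\<^bsub>dihedral_group n\<^esub> i)
      | i::nat. 1 \<le> i \<and> i \<le> n}"


section \<open>Non-commuting graphs and the detour polynomial\<close>

text \<open>
  An undirected simple graph is a loop-free symmetric pair digraph: an edge between \<open>x\<close> and
  \<open>y\<close> is represented by the two arcs \<open>(x, y)\<close> and \<open>(y, x)\<close>.
\<close>

definition noncommuting_graph :: "('a, 'b) monoid_scheme \<Rightarrow> 'a set \<Rightarrow> 'a pair_pre_digraph" where
  "noncommuting_graph G A =
    \<lparr> pverts = A,
      parcs = {(x, y). x \<in> A \<and> y \<in> A \<and> x \<noteq> y \<and> x \<otimes>\<^bsub>G\<^esub> y \<noteq> y \<otimes>\<^bsub>G\<^esub> x} \<rparr>"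

text \<open>
  \<open>apath u p v\<close> says that the arc list \<open>p\<close> is a walk from \<open>u\<close> to \<open>v\<close> without repeated vertices.
  The value is meaningful only if such a path exists and path lengths are bounded, as is the
  case in a finite connected graph.
\<close>

definition detour_distance :: "'a pair_pre_digraph \<Rightarrow> 'a \<Rightarrow> 'a \<Rightarrow> nat" where
  "detour_distance \<Gamma> u v = Max {length p | p. pre_digraph.apath (with_proj \<Gamma>) u p v}"

text \<open>
  Unordered pairs of distinct vertices are the two-element sets of vertices. As the graph is
  undirected, \<open>detour_distance \<Gamma> u v = detour_distance \<Gamma> v u\<close>, so the exponent does not depend on
  how such a set is written as \<open>{u, v}\<close>.
\<close>

definition detour_polynomial :: "'a pair_pre_digraph \<Rightarrow> int poly" where
  "detour_polynomial \<Gamma> =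
    (\<Sum>e\<in>{e. e \<subseteq> pverts \<Gamma> \<and> card e = 2}.
      monom 1 (THE d. \<exists>u v. e = {u, v} \<and> d = detour_distance \<Gamma> u v))"

end

theory Submission
  imports Defs "HOL-Algebra.Coset" "HOL-Number_Theory.Cong"
begin

text \<open>
  The theorem rests on a fact about every finite group \<open>G\<close>: in the non-commuting graph on the \<open>N\<close>
  non-central elements, any two distinct vertices are joined by a Hamiltonian path. All detour
  distances are then \<open>N - 1\<close>, and the detour polynomial is \<open>(N choose 2) x^(N - 1)\<close>
  (\<open>detour_polynomial_noncommuting_graph\<close>).

  The reason is a degree count. A non-central \<open>x\<close> is adjacent to all elements outside its
  centralizer, which by Lagrange contains at most half of \<open>G\<close>. So the degrees of two vertices add up
  to at least \<open>|G|\<close>, that is, to at least \<open>N + 1\<close>, since the identity is central. This is the hypothesis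
  of Ore's criterion for Hamiltonian paths with prescribed ends (\<open>Ore_Hamilton_connected\<close>), which
  is proved by repairing a non-adjacent consecutive pair in an ordering of the vertices by reversal
  of a suitable block.

  It remains to find \<open>N\<close> for the dihedral group, where \<open>|G| = 2n\<close> and the centre has one element for
  odd \<open>n\<close> and two for even \<open>n\<close>; hence \<open>N = 2n - 1\<close> or \<open>N = 2n - 2\<close>. As the group is given by a
  presentation, the relations only bound it from above: they bring each word into one of the \<open>2n\<close>
  forms \<open>r^i\<close>, \<open>s r^i\<close> with \<open>1 \<le> i \<le> n\<close>. That these are different elements is seen from the action on
  the corners of the regular \<open>n\<close>-gon (\<open>word_eq_iff_act_cong\<close>), which also decides which elements
  commute.
\<close>

section \<open>Ore's criterion for Hamilton-connected graphs\<close>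

text \<open>
  A list of all vertices is read as an attempt at a Hamiltonian path; \<open>gaps\<close> measures how far it is
  from being one.
\<close>

fun gaps :: "('a \<Rightarrow> 'a \<Rightarrow> bool) \<Rightarrow> 'a list \<Rightarrow> nat" where
  "gaps E (x # y # zs) = (if E x y then 0 else 1) + gaps E (y # zs)"
| "gaps E _ = 0"

lemma gaps_append:
  "xs \<noteq> [] \<Longrightarrow> ys \<noteq> [] \<Longrightarrow>
    gaps E (xs @ ys) = gaps E xs + (if E (last xs) (hd ys) then 0 else 1) + gaps E ys"
proof (induction E xs rule: gaps.induct)
  case ("2_2" E v)
  then show ?case by (cases ys) auto
qed auto

lemma gaps_rev:
  assumes "symp E"
  shows "gaps E (rev xs) = gaps E xs"
proof (induction xs)
  case (Cons x xs)
  show ?case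
  proof (cases xs)
    case (Cons y ys)
    then have "gaps E (rev (x # xs)) = gaps E (rev xs) + (if E y x then 0 else 1)"
      using gaps_append[of "rev xs" "[x]" E] by (simp add: last_rev)
    then show ?thesis
      using Cons.IH sympD[OF assms] Cons by auto
  qed simp
qed simp

lemma gaps_eq_0_iff: "gaps E xs = 0 \<longleftrightarrow> successively E xs"
  by (induction E xs rule: gaps.induct) auto

lemma gaps_pos_obtains:
  assumes "0 < gaps E xs"
  obtains i where "Suc i < length xs" "\<not> E (xs ! i) (xs ! Suc i)"
  using assms by (metis gaps_eq_0_iff successively_conv_nth not_gr_zero)

text \<open>
  Reversing the block strictly between positions \<open>i\<close> and \<open>j + 1\<close> changes only its two junctions with
  the rest of the list: the steps \<open>i, i + 1\<close> and \<open>j, j + 1\<close> are replaced by \<open>i, j\<close> and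
  \<open>i + 1, j + 1\<close>. If both new steps are edges and one of the old ones was not, a gap has
  disappeared. The first and the last vertex stay in place, because they lie outside the block.
\<close>

lemma gaps_reverse_block:
  assumes "symp E" "i < j" "Suc j < length p"
    and gap: "\<not> E (p ! i) (p ! Suc i) \<or> \<not> E (p ! j) (p ! Suc j)"
    and new: "E (p ! i) (p ! j)" "E (p ! Suc i) (p ! Suc j)"
  obtains q where "mset q = mset p" "hd q = hd p" "last q = last p" "gaps E q < gaps E p"
proof
  define A where "A = take (Suc i) p"
  define B where "B = take (j - i) (drop (Suc i) p)"
  define C where "C = drop (Suc j) p"
  have "take (j - i) (drop (Suc i) p) @ drop (j - i) (drop (Suc i) p) = drop (Suc i) p"
    by (rule append_take_drop_id)
  moreover have "drop (j - i) (drop (Suc i) p) = C"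
    using assms by (simp add: C_def)
  ultimately have p: "p = A @ B @ C"
    by (simp add: A_def B_def)
  have ne: "A \<noteq> []" "B \<noteq> []" "C \<noteq> []"
    using assms by (auto simp: A_def B_def C_def)
  have ends: "last A = p ! i" "hd B = p ! Suc i" "last B = p ! j" "hd C = p ! Suc j"
    using assms ne
    by (auto simp: A_def B_def C_def last_conv_nth hd_conv_nth)
  show "mset (A @ rev B @ C) = mset p" "hd (A @ rev B @ C) = hd p" "last (A @ rev B @ C) = last p"
    using ne by (simp_all add: p)
  have "gaps E p = gaps E A + gaps E B + gaps E C
      + (if E (last A) (hd B) then 0 else 1) + (if E (last B) (hd C) then 0 else 1)"
    using ne by (simp add: p gaps_append)
  moreover have "gaps E (A @ rev B @ C) = gaps E A + gaps E B + gaps E C"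
    using ne new by (simp add: gaps_append gaps_rev[OF \<open>symp E\<close>] ends hd_rev last_rev)
  ultimately show "gaps E (A @ rev B @ C) < gaps E p"
    using gap by (auto simp: ends)
qed

text \<open>
  A pigeonhole count finds the place for the exchange. Every neighbour of \<open>p ! i\<close> except
  possibly the last vertex is the left end of a step of the list, and every neighbour of
  \<open>p ! Suc i\<close> except possibly the first vertex is the right end of a step. Step \<open>i\<close> itself is never
  counted, as there are no loops. So more than \<open>length p - 2\<close> steps are counted, with
  multiplicity, among the \<open>length p - 2\<close> steps other than \<open>i\<close>, and some step \<open>j\<close> is counted twice.
\<close>

lemma Ore_crossing:
  assumes p: "distinct p" and "irreflp E" and i: "Suc i < length p"
    and deg: "length p < card {z \<in> set p. E (p ! i) z} + card {z \<in> set p. E (p ! Suc i) z}"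
  obtains j where "Suc j < length p" "j \<noteq> i" "E (p ! i) (p ! j)" "E (p ! Suc i) (p ! Suc j)"
proof -
  define L where "L = length p"
  define S where "S = {..<L - 1} - {i}"
  define A where "A = {j \<in> S. E (p ! i) (p ! j)}"
  define B where "B = {j \<in> S. E (p ! Suc i) (p ! Suc j)}"
  have irr: "\<not> E x x" for x
    using \<open>irreflp E\<close> by (simp add: irreflp_def)
  have fin: "finite A" "finite B"
    by (simp_all add: A_def B_def S_def)
  have "{z \<in> set p. E (p ! i) z} \<subseteq> insert (p ! (L - 1)) ((!) p ` A)"
  proof
    fix z assume "z \<in> {z \<in> set p. E (p ! i) z}"
    then obtain k where k: "k < L" "z = p ! k" "E (p ! i) (p ! k)"
      by (auto simp: in_set_conv_nth L_def)
    then show "z \<in> insert (p ! (L - 1)) ((!) p ` A)"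
      using irr by (cases "k = L - 1") (auto simp: A_def S_def)
  qed
  from card_mono[OF _ this] have cA: "card {z \<in> set p. E (p ! i) z} \<le> Suc (card A)"
    using card_image_le[OF fin(1), of "(!) p"] fin(1)
    by (auto intro: order.trans simp: card_insert_if split: if_splits)
  have "{z \<in> set p. E (p ! Suc i) z} \<subseteq> insert (p ! 0) ((\<lambda>j. p ! Suc j) ` B)"
  proof
    fix z assume "z \<in> {z \<in> set p. E (p ! Suc i) z}"
    then obtain k where k: "k < L" "z = p ! k" "E (p ! Suc i) (p ! k)"
      by (auto simp: in_set_conv_nth L_def)
    then show "z \<in> insert (p ! 0) ((\<lambda>j. p ! Suc j) ` B)"
      using irr by (cases k) (auto simp: B_def S_def)
  qed
  from card_mono[OF _ this] have cB: "card {z \<in> set p. E (p ! Suc i) z} \<le> Suc (card B)"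
    using card_image_le[OF fin(2), of "\<lambda>j. p ! Suc j"] fin(2)
    by (auto intro: order.trans simp: card_insert_if split: if_splits)
  have "card S = L - 2"
    using i by (simp add: S_def L_def)
  have "A \<inter> B \<noteq> {}"
  proof
    assume "A \<inter> B = {}"
    then have "card A + card B = card (A \<union> B)"
      using fin by (simp add: card_Un_disjoint)
    also have "\<dots> \<le> card S"
      by (intro card_mono) (auto simp: A_def B_def S_def)
    finally show False
      using cA cB deg i \<open>card S = L - 2\<close> by (simp add: L_def)
  qed
  then obtain j where "j \<in> A" "j \<in> B"
    by blast
  then show ?thesis
    by (intro that[of j]) (auto simp: A_def B_def S_def L_def)
qed

text \<open>
  Ore's criterion for Hamilton-connectedness. Among all orderings of the vertices that start
  at \<open>u\<close> and end at \<open>v\<close>, one with the fewest gaps has none: otherwise the degree condition at a gap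
  yields an exchange that lowers the number of gaps.
\<close>

lemma Ore_Hamilton_connected:
  assumes fin: "finite V" and "symp E" "irreflp E"
    and deg: "\<And>x y. x \<in> V \<Longrightarrow> y \<in> V \<Longrightarrow> x \<noteq> y \<Longrightarrow> \<not> E x y \<Longrightarrow>
      card V < card {z \<in> V. E x z} + card {z \<in> V. E y z}"
    and uv: "u \<in> V" "v \<in> V" "u \<noteq> v"
  obtains p where "distinct p" "set p = V" "hd p = u" "last p = v" "successively E p"
proof -
  define ok where "ok p \<longleftrightarrow> distinct p \<and> set p = V \<and> hd p = u \<and> last p = v" for p
  obtain m where m: "set m = V - {u, v}" "distinct m"
    using finite_distinct_list[of "V - {u, v}"] fin by auto
  have "ok (u # m @ [v])"
    using m uv by (auto simp: ok_def)
  then obtain p where "ok p" and min: "\<And>q. ok q \<Longrightarrow> gaps E p \<le> gaps E q"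
    using ex_has_least_nat[of ok _ "gaps E"] by blast
  have "gaps E p = 0"
  proof (rule ccontr)
    assume "gaps E p \<noteq> 0"
    then obtain i where i: "Suc i < length p" and gap: "\<not> E (p ! i) (p ! Suc i)"
      using gaps_pos_obtains by blast
    have p: "distinct p" "set p = V" "hd p = u" "last p = v"
      using \<open>ok p\<close> by (simp_all add: ok_def)
    have "p ! i \<in> V" "p ! Suc i \<in> V" "p ! i \<noteq> p ! Suc i"
      using p i by (auto simp: nth_eq_iff_index_eq simp flip: p(2))
    from deg[OF this gap] obtain j where
      j: "Suc j < length p" "j \<noteq> i" "E (p ! i) (p ! j)" "E (p ! Suc i) (p ! Suc j)"
      using Ore_crossing[OF p(1) \<open>irreflp E\<close> i] p by (metis distinct_card)
    obtain q where q: "mset q = mset p" "hd q = hd p" "last q = last p" "gaps E q < gaps E p"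
    proof (cases "i < j")
      case True
      then show ?thesis
        using gaps_reverse_block[OF \<open>symp E\<close> True j(1)] gap j that by blast
    next
      case False
      then have "j < i" using j by simp
      then show ?thesis
        using gaps_reverse_block[OF \<open>symp E\<close> \<open>j < i\<close> i] gap j sympD[OF \<open>symp E\<close>] that
        by blast
    qed
    have "ok q"
      using q p by (metis ok_def mset_eq_imp_distinct_iff mset_eq_setD)
    then show False
      using min q(4) by fastforce
  qed
  then show ?thesis
    using that \<open>ok p\<close> by (auto simp: ok_def gaps_eq_0_iff)
qed

section \<open>Detour polynomials of Hamilton-connected graphs\<close>

lemma apath_of_vertex_list:
  assumes "p \<noteq> []" "distinct p" "set p \<subseteq> pverts \<Gamma>"
    and "successively (\<lambda>x y. (x, y) \<in> parcs \<Gamma>) p"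
  shows "pre_digraph.apath (with_proj \<Gamma>) (hd p) (zip p (tl p)) (last p)"
proof -
  have "pcas (hd p) (zip p (tl p)) (last p) \<and> pawalk_verts (hd p) (zip p (tl p)) = p
      \<and> set (zip p (tl p)) \<subseteq> parcs \<Gamma>"
    using assms(1,4) by (induction p rule: induct_list012) auto
  then show ?thesis
    using assms
    by (auto simp: pre_digraph.apath_def pre_digraph.awalk_def cas_with_proj_eq
        awalk_verts_with_proj_eq)
qed

lemma detour_distance_Hamiltonian:
  assumes "finite (pverts \<Gamma>)" "parcs \<Gamma> \<subseteq> pverts \<Gamma> \<times> pverts \<Gamma>"
    and p: "distinct p" "set p = pverts \<Gamma>" "p \<noteq> []"
    and arcs: "successively (\<lambda>x y. (x, y) \<in> parcs \<Gamma>) p"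
  shows "detour_distance \<Gamma> (hd p) (last p) = card (pverts \<Gamma>) - 1"
proof -
  interpret pair_fin_digraph \<Gamma>
    using assms by unfold_locales (auto intro: finite_subset)
  let ?L = "{length q | q. apath (hd p) q (last p)}"
  have le: "l \<le> card (pverts \<Gamma>) - 1" if "l \<in> ?L" for l
    using that length_apath_less by fastforce
  have "length (zip p (tl p)) \<in> ?L"
    using apath_of_vertex_list[of p \<Gamma>] p arcs by blast
  moreover have "length (zip p (tl p)) = card (pverts \<Gamma>) - 1"
    using p by (simp flip: distinct_card)
  moreover have "finite ?L"
    by (rule finite_subset[of _ "{..card (pverts \<Gamma>) - 1}"]) (use le in auto)
  ultimately show ?thesis
    unfolding detour_distance_def using le by (intro Max_eqI) auto
qed

text \<open>
  A path cannot be longer than a Hamiltonian one, so in a Hamilton-connected graph every pair of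
  distinct vertices contributes the same monomial, and only the number of pairs matters.
\<close>

lemma detour_polynomial_Hamilton_connected:
  assumes "finite (pverts \<Gamma>)" "parcs \<Gamma> \<subseteq> pverts \<Gamma> \<times> pverts \<Gamma>"
    and "\<And>u v. u \<in> pverts \<Gamma> \<Longrightarrow> v \<in> pverts \<Gamma> \<Longrightarrow> u \<noteq> v \<Longrightarrow>
      \<exists>p. distinct p \<and> set p = pverts \<Gamma> \<and> hd p = u \<and> last p = v
        \<and> successively (\<lambda>x y. (x, y) \<in> parcs \<Gamma>) p"
  shows "detour_polynomial \<Gamma> =
    monom (int (card (pverts \<Gamma>) choose 2)) (card (pverts \<Gamma>) - 1)"
proof -
  let ?V = "pverts \<Gamma>"
  have dist: "detour_distance \<Gamma> u v = card ?V - 1" if "u \<in> ?V" "v \<in> ?V" "u \<noteq> v" for u v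
    using assms(3)[OF that] detour_distance_Hamiltonian[OF assms(1,2)] that
    by (metis empty_iff empty_set)
  have the: "(THE d. \<exists>u v. e = {u, v} \<and> d = detour_distance \<Gamma> u v) = card ?V - 1"
    if "e \<subseteq> ?V" "card e = 2" for e
  proof (rule the_equality)
    show "\<exists>u v. e = {u, v} \<and> card ?V - 1 = detour_distance \<Gamma> u v"
    proof -
      obtain u v where "e = {u, v}" "u \<noteq> v"
        using \<open>card e = 2\<close> by (auto simp: card_2_iff)
      then show ?thesis
        using dist[of u v] \<open>e \<subseteq> ?V\<close> by force
    qed
    show "d = card ?V - 1" if d: "\<exists>u v. e = {u, v} \<and> d = detour_distance \<Gamma> u v" for d
    proof -
      obtain u v where "e = {u, v}" "d = detour_distance \<Gamma> u v"
        using d by blast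
      moreover then have "u \<noteq> v"
        using \<open>card e = 2\<close> by auto
      ultimately show ?thesis
        using dist \<open>e \<subseteq> ?V\<close> by simp
    qed
  qed
  have "detour_polynomial \<Gamma> = (\<Sum>e\<in>{e. e \<subseteq> ?V \<and> card e = 2}. monom 1 (card ?V - 1))"
    unfolding detour_polynomial_def by (rule sum.cong) (simp_all add: the)
  also have "\<dots> = of_nat (card ?V choose 2) * monom 1 (card ?V - 1)"
    using n_subsets[OF assms(1), of 2] by simp
  finally show ?thesis
    by (simp add: of_nat_monom mult_monom)
qed

section \<open>Non-commuting graphs of finite groups\<close>

definition centralizer :: "('a, 'b) monoid_scheme \<Rightarrow> 'a \<Rightarrow> 'a set" where
  "centralizer G x = {y \<in> carrier G. x \<otimes>\<^bsub>G\<^esub> y = y \<otimes>\<^bsub>G\<^esub> x}"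

lemma (in group) subgroup_centralizer:
  assumes x: "x \<in> carrier G"
  shows "subgroup (centralizer G x) G"
proof
  fix a b assume "a \<in> centralizer G x" "b \<in> centralizer G x"
  then have ab: "a \<in> carrier G" "b \<in> carrier G" "x \<otimes> a = a \<otimes> x" "x \<otimes> b = b \<otimes> x"
    by (auto simp: centralizer_def)
  have "x \<otimes> (a \<otimes> b) = (a \<otimes> b) \<otimes> x"
    using ab x by (metis m_assoc)
  then show "a \<otimes> b \<in> centralizer G x"
    using ab by (simp add: centralizer_def)
  have "inv a \<otimes> (x \<otimes> a) \<otimes> inv a = inv a \<otimes> (a \<otimes> x) \<otimes> inv a"
    using ab by simp
  then have "x \<otimes> inv a = inv a \<otimes> x"
    using ab x by (metis inv_closed inv_solve_right m_assoc m_closed r_inv r_one l_inv l_one)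
  then show "inv a \<in> centralizer G x"
    using ab by (simp add: centralizer_def)
qed (use x in \<open>auto simp: centralizer_def\<close>)

text \<open>
  The centralizer of a non-central element is a proper subgroup, so by Lagrange its index is at
  least 2.
\<close>

lemma (in group) two_card_centralizer_le:
  assumes fin: "finite (carrier G)" and x: "x \<in> carrier G - group_center G"
  shows "2 * card (centralizer G x) \<le> card (carrier G)"
proof -
  have sub: "subgroup (centralizer G x) G"
    using x by (auto intro: subgroup_centralizer)
  have "card (rcosets (centralizer G x)) * card (centralizer G x) = card (carrier G)"
    using lagrange[OF sub] by (simp add: order_def)
  moreover have "card (centralizer G x) < card (carrier G)"
    using x by (intro psubset_card_mono[OF fin]) (auto simp: centralizer_def group_center_def)
  moreover have "0 < card (carrier G)"
    using fin by (auto simp: card_gt_0_iff)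
  ultimately have "2 \<le> card (rcosets (centralizer G x))"
    by (metis One_nat_def Suc_1 Suc_leI less_irrefl mult.left_neutral mult_is_0 neq0_conv
        not_less_eq_eq le_Suc_eq le_0_eq)
  then show ?thesis
    using \<open>card (rcosets _) * _ = _\<close> by (metis mult_le_mono1)
qed

text \<open>
  The neighbours of a vertex \<open>x\<close> are exactly the group elements outside its centralizer, hence at
  least half of the group. Two degrees therefore add up to at least the order of the group, which
  exceeds the number of vertices because the identity is not a vertex. So Ore's criterion applies
  to every pair of vertices, whatever the group.
\<close>

lemma (in group) detour_polynomial_noncommuting_graph:
  assumes fin: "finite (carrier G)"
  defines "V \<equiv> carrier G - group_center G"
  shows "detour_polynomial (noncommuting_graph G V) = monom (int (card V choose 2)) (card V - 1)"
proof -
  define E where "E x y \<longleftrightarrow> x \<in> V \<and> y \<in> V \<and> x \<otimes> y \<noteq> y \<otimes> x" for x y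
  have arcs: "(\<lambda>x y. (x, y) \<in> parcs (noncommuting_graph G V)) = E"
    by (auto simp: noncommuting_graph_def E_def fun_eq_iff)
  have verts: "pverts (noncommuting_graph G V) = V"
    by (simp add: noncommuting_graph_def)
  have finV: "finite V"
    using fin by (simp add: V_def)
  have "\<one> \<in> carrier G - V"
    by (auto simp: V_def group_center_def)
  then have "card V < card (carrier G)"
    using fin by (intro psubset_card_mono) (auto simp: V_def)
  have half: "card (carrier G) \<le> 2 * card {z \<in> V. E x z}" if "x \<in> V" for x
  proof -
    have "{z \<in> V. E x z} = carrier G - centralizer G x"
      using that unfolding E_def V_def centralizer_def group_center_def by (auto, metis+)
    moreover have "card (carrier G - centralizer G x) = card (carrier G) - card (centralizer G x)"
      using fin by (intro card_Diff_subset) (auto simp: centralizer_def intro: finite_subset)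
    moreover have "2 * card (centralizer G x) \<le> card (carrier G)"
      using two_card_centralizer_le[OF fin] that by (simp add: V_def)
    ultimately show ?thesis
      by simp
  qed
  have "detour_polynomial (noncommuting_graph G V) =
    monom (int (card (pverts (noncommuting_graph G V)) choose 2))
      (card (pverts (noncommuting_graph G V)) - 1)"
  proof (rule detour_polynomial_Hamilton_connected; unfold verts arcs)
    show "finite V" by (rule finV)
    show "parcs (noncommuting_graph G V) \<subseteq> V \<times> V"
      by (auto simp: noncommuting_graph_def)
    fix u v assume uv: "u \<in> V" "v \<in> V" "u \<noteq> v"
    have "symp E" "irreflp E"
      by (auto simp: E_def symp_def irreflp_def)
    moreover have "card V < card {z \<in> V. E x z} + card {z \<in> V. E y z}" if "x \<in> V" "y \<in> V" for x y
      using half[OF that(1)] half[OF that(2)] \<open>card V < card (carrier G)\<close> by linarith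
    ultimately show "\<exists>p. distinct p \<and> set p = V \<and> hd p = u \<and> last p = v \<and> successively E p"
      using Ore_Hamilton_connected[OF finV _ _ _ uv, of E] by metis
  qed
  then show ?thesis
    by (simp add: verts)
qed

section \<open>A faithful action of the dihedral group\<close>

abbreviation rot_word :: "nat \<Rightarrow> dihedral_gen word" where
  "rot_word i \<equiv> replicate i (Gen_r, False)"

abbreviation refl_word :: "nat \<Rightarrow> dihedral_gen word" where
  "refl_word i \<equiv> (Gen_s, False) # rot_word i"

text \<open>
  The group acts on the residues modulo \<open>n\<close>, the corners of the \<open>n\<close>-gon: \<open>r\<close> is the rotation
  \<open>x \<mapsto> x + 1\<close> and \<open>s\<close> the reflection \<open>x \<mapsto> - x\<close>. Words act on integers, and their values matter only
  modulo \<open>n\<close>; this avoids a type of residues that depends on \<open>n\<close>.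
\<close>

fun letter_act :: "dihedral_gen \<times> bool \<Rightarrow> int \<Rightarrow> int" where
  "letter_act (Gen_r, b) x = (if b then x - 1 else x + 1)"
| "letter_act (Gen_s, b) x = - x"

abbreviation word_act :: "dihedral_gen word \<Rightarrow> int \<Rightarrow> int" where
  "word_act \<equiv> foldr letter_act"

text \<open>
  The left-hand side is the simplifier's normal form of \<open>word_act (rot_word i) x\<close>.
\<close>

lemma word_act_rot [simp]: "(letter_act (Gen_r, False) ^^ i) x = x + int i"
  by (induction i) auto

lemma letter_act_cong: "[x = y] (mod m) \<Longrightarrow> [letter_act l x = letter_act l y] (mod m)"
  by (cases "(l, x)" rule: letter_act.cases)
    (auto intro: cong_add cong_diff simp: cong_minus_minus_iff)

lemma word_act_cong: "[x = y] (mod m) \<Longrightarrow> [word_act w x = word_act w y] (mod m)"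
  by (induction w) (auto intro: letter_act_cong)

lemma word_eq_imp_act_cong:
  "word_eq (dihedral_relations n) u v \<Longrightarrow> [word_act u x = word_act v x] (mod int n)"
proof (induction arbitrary: x rule: word_eq.induct)
  case (rel u v)
  then show ?case
    by (auto simp: dihedral_relations_def cong_def)
next
  case (cancel g b)
  then show ?case by (cases g) auto
next
  case (cong u u' v v')
  have "[word_act u (word_act v x) = word_act u' (word_act v' x)] (mod int n)"
    using cong.IH(1) word_act_cong[OF cong.IH(2)] cong_trans by blast
  then show ?case by simp
qed (auto intro: cong_sym cong_trans)

section \<open>Normal forms\<close>

interpretation dihedral: group "dihedral_group n" for n
  unfolding dihedral_group_def by (rule group_presented_group)

lemma dihedral_mult:
  "word_class (dihedral_relations n) u \<otimes>\<^bsub>dihedral_group n\<^esub> word_class (dihedral_relations n) v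
    = word_class (dihedral_relations n) (u @ v)"
  by (simp add: dihedral_group_def presented_group_mult)

lemma dihedral_carrier: "carrier (dihedral_group n) = range (word_class (dihedral_relations n))"
  by (simp add: dihedral_group_def presented_group_def)

lemma dihedral_one: "\<one>\<^bsub>dihedral_group n\<^esub> = word_class (dihedral_relations n) []"
  by (simp add: dihedral_group_def presented_group_def)

lemma dihedral_r_pow:
  "dihedral_r n [^]\<^bsub>dihedral_group n\<^esub> i = word_class (dihedral_relations n) (rot_word i)"
proof (induction i)
  case (Suc i)
  then show ?case
    by (simp add: dihedral.nat_pow_Suc dihedral_r_def dihedral_mult replicate_append_same)
qed (simp add: dihedral_one)

lemma dihedral_s_mult_rot:
  "dihedral_s n \<otimes>\<^bsub>dihedral_group n\<^esub> word_class (dihedral_relations n) (rot_word i)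
    = word_class (dihedral_relations n) (refl_word i)"
  by (simp add: dihedral_s_def dihedral_mult)

lemma dihedral_gens_closed [simp]:
  "dihedral_r n \<in> carrier (dihedral_group n)" "dihedral_s n \<in> carrier (dihedral_group n)"
  by (simp_all add: dihedral_carrier dihedral_r_def dihedral_s_def)

lemma dihedral_gen_relations:
  fixes n
  defines "G \<equiv> dihedral_group n" and "r \<equiv> dihedral_r n" and "s \<equiv> dihedral_s n"
  shows "r [^]\<^bsub>G\<^esub> n = \<one>\<^bsub>G\<^esub>" "s \<otimes>\<^bsub>G\<^esub> s = \<one>\<^bsub>G\<^esub>" "s \<otimes>\<^bsub>G\<^esub> r \<otimes>\<^bsub>G\<^esub> s = inv\<^bsub>G\<^esub> r"
    and "word_class (dihedral_relations n) [(Gen_r, True)] = inv\<^bsub>G\<^esub> r"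
    and "word_class (dihedral_relations n) [(Gen_s, True)] = s"
proof -
  let ?R = "dihedral_relations n"
  have eq: "word_class ?R (rot_word n) = word_class ?R []"
      "word_class ?R [(Gen_s, False), (Gen_s, False)] = word_class ?R []"
      "word_class ?R [(Gen_s, False), (Gen_r, False), (Gen_s, False)] = word_class ?R [(Gen_r, True)]"
    unfolding word_class_eq_iff by (rule word_eq.rel; simp add: dihedral_relations_def)+
  show "r [^]\<^bsub>G\<^esub> n = \<one>\<^bsub>G\<^esub>"
    by (simp add: r_def G_def dihedral_r_pow dihedral_one eq)
  show ss: "s \<otimes>\<^bsub>G\<^esub> s = \<one>\<^bsub>G\<^esub>"
    by (simp add: s_def G_def dihedral_s_def dihedral_mult dihedral_one eq)
  have inv: "word_class ?R [(g, True)] = inv\<^bsub>G\<^esub> (word_class ?R [(g, False)])" for g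
  proof -
    have "word_class ?R [(g, True)] \<otimes>\<^bsub>G\<^esub> word_class ?R [(g, False)] = \<one>\<^bsub>G\<^esub>"
      using word_eq.cancel[of ?R g True]
      by (simp add: G_def dihedral_mult dihedral_one word_class_eq_iff)
    then show ?thesis
      unfolding G_def by (intro dihedral.inv_equality[symmetric]) (auto simp: dihedral_carrier)
  qed
  show r': "word_class ?R [(Gen_r, True)] = inv\<^bsub>G\<^esub> r"
    by (simp add: inv r_def dihedral_r_def)
  show "s \<otimes>\<^bsub>G\<^esub> r \<otimes>\<^bsub>G\<^esub> s = inv\<^bsub>G\<^esub> r"
    unfolding r'[symmetric] 
    by (simp add: r_def s_def G_def dihedral_s_def dihedral_r_def dihedral_mult eq)
  have "inv\<^bsub>G\<^esub> s = s"
    using ss unfolding G_def s_def by (intro dihedral.inv_equality) simp_all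
  then show "word_class ?R [(Gen_s, True)] = s"
    by (simp add: inv s_def dihedral_s_def)
qed

text \<open>
  In this form the relation \<open>srs = inv r\<close> moves every occurrence of \<open>s\<close> to the left.
\<close>

lemma dihedral_swap:
  fixes n
  defines "G \<equiv> dihedral_group n" and "r \<equiv> dihedral_r n" and "s \<equiv> dihedral_s n"
  shows "r \<otimes>\<^bsub>G\<^esub> s = s \<otimes>\<^bsub>G\<^esub> inv\<^bsub>G\<^esub> r" "inv\<^bsub>G\<^esub> r \<otimes>\<^bsub>G\<^esub> s = s \<otimes>\<^bsub>G\<^esub> r"
proof -
  interpret group G
    by (simp add: G_def dihedral.group_axioms)
  have [simp]: "r \<in> carrier G" "s \<in> carrier G"
    by (simp_all add: G_def r_def s_def)
  note rel = dihedral_gen_relations[of n, folded G_def r_def s_def]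
  have "s \<otimes>\<^bsub>G\<^esub> inv\<^bsub>G\<^esub> r = (s \<otimes>\<^bsub>G\<^esub> s) \<otimes>\<^bsub>G\<^esub> (r \<otimes>\<^bsub>G\<^esub> s)"
    by (simp flip: rel(3) add: m_assoc)
  then show "r \<otimes>\<^bsub>G\<^esub> s = s \<otimes>\<^bsub>G\<^esub> inv\<^bsub>G\<^esub> r"
    by (simp add: rel(2))
  have "inv\<^bsub>G\<^esub> r \<otimes>\<^bsub>G\<^esub> s = s \<otimes>\<^bsub>G\<^esub> r \<otimes>\<^bsub>G\<^esub> (s \<otimes>\<^bsub>G\<^esub> s)"
    by (simp flip: rel(3) add: m_assoc)
  then show "inv\<^bsub>G\<^esub> r \<otimes>\<^bsub>G\<^esub> s = s \<otimes>\<^bsub>G\<^esub> r"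
    by (simp add: rel(2))
qed

text \<open>
  Integer exponents let the induction pass \<open>r\<close> and its inverse alike; the relation \<open>r^n = 1\<close> reduces
  the exponent afterwards.
\<close>

lemma dihedral_normal_form_int:
  fixes n
  defines "G \<equiv> dihedral_group n" and "r \<equiv> dihedral_r n" and "s \<equiv> dihedral_s n"
  shows "\<exists>k::int. word_class (dihedral_relations n) w = r [^]\<^bsub>G\<^esub> k
    \<or> word_class (dihedral_relations n) w = s \<otimes>\<^bsub>G\<^esub> r [^]\<^bsub>G\<^esub> k"
proof -
  interpret group G
    by (simp add: G_def dihedral.group_axioms)
  have [simp]: "r \<in> carrier G" "s \<in> carrier G"
    by (simp_all add: G_def r_def s_def)
  note rel = dihedral_gen_relations[of n, folded G_def r_def s_def]
  note swap = dihedral_swap[of n, folded G_def r_def s_def]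
  let ?cl = "word_class (dihedral_relations n)"
  show ?thesis
  proof (induction w)
    case Nil
    have "?cl [] = r [^]\<^bsub>G\<^esub> (0::int)"
      using dihedral_one[of n] by (simp add: G_def)
    then show ?case by blast
  next
    case (Cons l w)
    have "?cl [l] \<in> {r, inv\<^bsub>G\<^esub> r, s}"
    proof (cases l)
      case (Pair g b)
      then show ?thesis
        using rel(4,5) by (cases g; cases b) (auto simp: r_def s_def dihedral_r_def dihedral_s_def)
    qed
    then have l: "?cl [l] = r [^]\<^bsub>G\<^esub> (1::int) \<or> ?cl [l] = r [^]\<^bsub>G\<^esub> (-1::int) \<or> ?cl [l] = s"
      by (auto simp: int_pow_neg)
    have lw: "?cl (l # w) = ?cl [l] \<otimes>\<^bsub>G\<^esub> ?cl w"
      by (simp add: G_def dihedral_mult)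
    have add: "r [^]\<^bsub>G\<^esub> i \<otimes>\<^bsub>G\<^esub> r [^]\<^bsub>G\<^esub> k = r [^]\<^bsub>G\<^esub> (i + k)" for i k :: int
      by (simp add: int_pow_mult)
    have s1: "r [^]\<^bsub>G\<^esub> (1::int) \<otimes>\<^bsub>G\<^esub> (s \<otimes>\<^bsub>G\<^esub> r [^]\<^bsub>G\<^esub> k) = s \<otimes>\<^bsub>G\<^esub> r [^]\<^bsub>G\<^esub> (-1 + k)" for k :: int
    proof -
      have "r \<otimes>\<^bsub>G\<^esub> (s \<otimes>\<^bsub>G\<^esub> r [^]\<^bsub>G\<^esub> k) = s \<otimes>\<^bsub>G\<^esub> (inv\<^bsub>G\<^esub> r \<otimes>\<^bsub>G\<^esub> r [^]\<^bsub>G\<^esub> k)"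
        using swap(1) by (metis \<open>r \<in> carrier G\<close> \<open>s \<in> carrier G\<close> int_pow_closed inv_closed m_assoc)
      then show ?thesis
        using add[of "-1" k] by (simp add: int_pow_neg)
    qed
    have s2: "r [^]\<^bsub>G\<^esub> (-1::int) \<otimes>\<^bsub>G\<^esub> (s \<otimes>\<^bsub>G\<^esub> r [^]\<^bsub>G\<^esub> k) = s \<otimes>\<^bsub>G\<^esub> r [^]\<^bsub>G\<^esub> (1 + k)" for k :: int
    proof -
      have "inv\<^bsub>G\<^esub> r \<otimes>\<^bsub>G\<^esub> (s \<otimes>\<^bsub>G\<^esub> r [^]\<^bsub>G\<^esub> k) = s \<otimes>\<^bsub>G\<^esub> (r \<otimes>\<^bsub>G\<^esub> r [^]\<^bsub>G\<^esub> k)"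
        using swap(2) by (metis \<open>r \<in> carrier G\<close> \<open>s \<in> carrier G\<close> int_pow_closed inv_closed m_assoc)
      then show ?thesis
        using add[of 1 k] by (simp add: int_pow_neg)
    qed
    have s3: "s \<otimes>\<^bsub>G\<^esub> (s \<otimes>\<^bsub>G\<^esub> r [^]\<^bsub>G\<^esub> k) = r [^]\<^bsub>G\<^esub> k" for k :: int
      using rel(2) by (simp flip: m_assoc)
    from Cons.IH l show ?case
      unfolding lw using add s1 s2 s3 by metis
  qed
qed

lemma dihedral_normal_form:
  assumes "n > 0"
  shows "\<exists>i\<in>{1..n}.
    word_class (dihedral_relations n) w = word_class (dihedral_relations n) (rot_word i)
    \<or> word_class (dihedral_relations n) w = word_class (dihedral_relations n) (refl_word i)"
proof -
  let ?G = "dihedral_group n" and ?r = "dihedral_r n"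
  obtain k :: int where k: "word_class (dihedral_relations n) w = ?r [^]\<^bsub>?G\<^esub> k
      \<or> word_class (dihedral_relations n) w = dihedral_s n \<otimes>\<^bsub>?G\<^esub> ?r [^]\<^bsub>?G\<^esub> k"
    using dihedral_normal_form_int by blast
  \<comment> \<open>The shift by 1 puts the representative of \<open>k\<close> modulo \<open>n\<close> into \<open>{1..n}\<close> instead of \<open>{0..<n}\<close>.\<close>
  define i where "i = nat ((k - 1) mod int n) + 1"
  have "int i = (k - 1) mod int n + 1"
    using assms by (simp add: i_def)
  then have "k = int i + int n * ((k - 1) div int n)"
    using mult_div_mod_eq[of "int n" "k - 1"] by linarith
  then have "?r [^]\<^bsub>?G\<^esub> k = ?r [^]\<^bsub>?G\<^esub> int i \<otimes>\<^bsub>?G\<^esub> ?r [^]\<^bsub>?G\<^esub> (int n * ((k - 1) div int n))"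
    by (metis dihedral.int_pow_mult dihedral_gens_closed(1))
  also have "?r [^]\<^bsub>?G\<^esub> (int n * ((k - 1) div int n)) = \<one>\<^bsub>?G\<^esub>"
    by (simp add: dihedral.int_pow_pow[symmetric] int_pow_int dihedral_gen_relations(1))
  finally have "?r [^]\<^bsub>?G\<^esub> k = ?r [^]\<^bsub>?G\<^esub> i"
    by (simp add: int_pow_int)
  then have "word_class (dihedral_relations n) w = word_class (dihedral_relations n) (rot_word i)
    \<or> word_class (dihedral_relations n) w = word_class (dihedral_relations n) (refl_word i)"
    using k by (simp only: dihedral_r_pow dihedral_s_mult_rot)
  moreover have "i \<in> {1..n}"
    using assms by (simp add: i_def Suc_le_eq nat_less_iff)
  ultimately show ?thesis
    by blast
qed

text \<open>
  A rotation preserves the difference of two points and a reflection negates it. So if the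
  two agree at \<open>0\<close> and at \<open>1\<close>, then \<open>n\<close> divides 2, which \<open>n \<ge> 3\<close> excludes.
\<close>

lemma normal_form_act_cong_iff:
  assumes n: "n \<ge> 3"
  shows "(\<forall>x. [word_act (rot_word i) x = word_act (rot_word j) x] (mod int n)) \<longleftrightarrow> [i = j] (mod n)"
    and "(\<forall>x. [word_act (refl_word i) x = word_act (refl_word j) x] (mod int n)) \<longleftrightarrow> [i = j] (mod n)"
    and "\<not> (\<forall>x. [word_act (rot_word i) x = word_act (refl_word j) x] (mod int n))"
proof -
  have small: "[i = j] (mod n) \<longleftrightarrow> [int i = int j] (mod int n)"
    by (simp add: cong_int_iff)
  show "(\<forall>x. [word_act (rot_word i) x = word_act (rot_word j) x] (mod int n)) \<longleftrightarrow> [i = j] (mod n)"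
    by (simp add: small cong_add_lcancel)
  have "[- a - b = - a - c] (mod m) \<longleftrightarrow> [b = c] (mod m)" for a b c m :: int
    by (metis cong_add_lcancel cong_minus_minus_iff diff_conv_add_uminus)
  then show "(\<forall>x. [word_act (refl_word i) x = word_act (refl_word j) x] (mod int n)) \<longleftrightarrow> [i = j] (mod n)"
    by (simp add: small)
  show "\<not> (\<forall>x. [word_act (rot_word i) x = word_act (refl_word j) x] (mod int n))"
  proof
    assume *: "\<forall>x. [word_act (rot_word i) x = word_act (refl_word j) x] (mod int n)"
    have "int n dvd (int i + int j)" "int n dvd (int i + int j + 2)"
      using *[rule_format, of 0] *[rule_format, of 1] by (simp_all add: cong_iff_dvd_diff algebra_simps)
    then have "int n dvd 2"
      by (metis dvd_add_right_iff)
    then show False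
      using n zdvd_imp_le by fastforce
  qed
qed

lemma cong_imp_eq_atLeast1_atMost:
  assumes "[i = j] (mod n)" "1 \<le> i" "i \<le> n" "1 \<le> j" "j \<le> (n::nat)"
  shows "i = j"
proof -
  have "[int i = int j] (mod int n)"
    using assms(1) by (simp add: cong_int_iff)
  then have "int n dvd int i - int j"
    by (simp add: cong_iff_dvd_diff)
  then show ?thesis
    using assms(2-5) dvd_imp_le_int[of "int i - int j" "int n"] by linarith
qed

text \<open>
  The action is faithful, because it separates the normal forms. Hence equality in the presented
  group, and with it commutation, becomes a computation with congruences.
\<close>

lemma word_eq_iff_act_cong:
  assumes n: "n \<ge> 3"
  shows "word_eq (dihedral_relations n) u v \<longleftrightarrow> (\<forall>x. [word_act u x = word_act v x] (mod int n))"
proof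
  let ?R = "dihedral_relations n"
  assume act: "\<forall>x. [word_act u x = word_act v x] (mod int n)"
  have nf: "\<exists>i\<in>{1..n}. word_eq ?R w (rot_word i) \<or> word_eq ?R w (refl_word i)" for w
    using dihedral_normal_form[of n w] n unfolding word_class_eq_iff by simp
  obtain i where i: "i \<in> {1..n}" "word_eq ?R u (rot_word i) \<or> word_eq ?R u (refl_word i)"
    using nf by blast
  obtain j where j: "j \<in> {1..n}" "word_eq ?R v (rot_word j) \<or> word_eq ?R v (refl_word j)"
    using nf by blast
  have transfer: "\<forall>x. [word_act a x = word_act b x] (mod int n)"
    if "word_eq ?R u a" "word_eq ?R v b" for a b
    using cong_trans[OF cong_trans[OF cong_sym[OF word_eq_imp_act_cong[OF that(1)]]
          act[rule_format]] word_eq_imp_act_cong[OF that(2)]] by blast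
  have ij: "i = j" if "[i = j] (mod n)"
    using cong_imp_eq_atLeast1_atMost[OF that] i j by simp
  have not_mixed: "\<not> (\<forall>x. [word_act (refl_word i) x = word_act (rot_word j) x] (mod int n))"
    using normal_form_act_cong_iff(3)[OF n] cong_sym by blast
  from i(2) j(2) have "\<exists>a. word_eq ?R u a \<and> word_eq ?R v a"
  proof (elim disjE)
    assume "word_eq ?R u (rot_word i)" "word_eq ?R v (rot_word j)"
    then show ?thesis
      using transfer normal_form_act_cong_iff(1)[OF n] ij by blast
  next
    assume "word_eq ?R u (refl_word i)" "word_eq ?R v (refl_word j)"
    then show ?thesis
      using transfer normal_form_act_cong_iff(2)[OF n] ij by blast
  next
    assume "word_eq ?R u (rot_word i)" "word_eq ?R v (refl_word j)"
    then show ?thesis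
      using transfer normal_form_act_cong_iff(3)[OF n] by blast
  next
    assume "word_eq ?R u (refl_word i)" "word_eq ?R v (rot_word j)"
    then show ?thesis
      using transfer not_mixed by blast
  qed
  then show "word_eq ?R u v"
    using word_eq.trans[OF _ word_eq.sym] by blast
qed (auto intro: word_eq_imp_act_cong)

lemma dihedral_elements:
  assumes "n > 0"
  shows "carrier (dihedral_group n) =
    {dihedral_r n [^]\<^bsub>dihedral_group n\<^esub> i | i::nat. 1 \<le> i \<and> i \<le> n} \<union> dihedral_Omega2 n"
  unfolding dihedral_Omega2_def dihedral_r_pow dihedral_s_mult_rot dihedral_carrier
proof (rule equalityI; rule subsetI)
  fix x assume "x \<in> range (word_class (dihedral_relations n))"
  then obtain w where w: "x = word_class (dihedral_relations n) w"
    by blast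
  obtain i where "i \<in> {1..n}" "x = word_class (dihedral_relations n) (rot_word i)
      \<or> x = word_class (dihedral_relations n) (refl_word i)"
    using dihedral_normal_form[OF assms, of w] unfolding w by blast
  then show "x \<in> {word_class (dihedral_relations n) (rot_word i) | i. 1 \<le> i \<and> i \<le> n}
      \<union> {word_class (dihedral_relations n) (refl_word i) | i. 1 \<le> i \<and> i \<le> n}"
    by auto
qed auto

section \<open>Order and centre of the dihedral group\<close>

lemma order_dihedral:
  assumes n: "n \<ge> 3"
  shows "finite (carrier (dihedral_group n))" "card (carrier (dihedral_group n)) = 2 * n"
proof -
  let ?rot = "\<lambda>i. word_class (dihedral_relations n) (rot_word i)"
  let ?refl = "\<lambda>i. word_class (dihedral_relations n) (refl_word i)"
  have carrier: "carrier (dihedral_group n) = ?rot ` {1..n} \<union> ?refl ` {1..n}"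
    using n by (subst dihedral_elements)
      (auto simp: dihedral_Omega2_def dihedral_r_pow dihedral_s_mult_rot)
  then show "finite (carrier (dihedral_group n))"
    by simp
  have "inj_on ?rot {1..n}" "inj_on ?refl {1..n}"
    unfolding inj_on_def word_class_eq_iff word_eq_iff_act_cong[OF n] normal_form_act_cong_iff(1,2)[OF n]
    using cong_imp_eq_atLeast1_atMost by auto
  moreover have "?rot i \<noteq> ?refl j" for i j
    unfolding word_class_eq_iff word_eq_iff_act_cong[OF n] by (rule normal_form_act_cong_iff(3)[OF n])
  then have "?rot ` {1..n} \<inter> ?refl ` {1..n} = {}"
    by blast
  ultimately show "card (carrier (dihedral_group n)) = 2 * n"
    by (simp add: carrier card_Un_disjoint card_image)
qed

lemma word_class_in_center_iff:
  assumes n: "n \<ge> 3"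
  shows "word_class (dihedral_relations n) u \<in> group_center (dihedral_group n) \<longleftrightarrow>
    (\<forall>v x. [word_act u (word_act v x) = word_act v (word_act u x)] (mod int n))"
  by (auto simp: group_center_def dihedral_carrier dihedral_mult word_class_eq_iff
      word_eq_iff_act_cong[OF n])

text \<open>
  A reflection does not commute with \<open>r\<close>: the two products differ by 2 at the point \<open>0\<close>.
\<close>

lemma refl_not_central:
  assumes n: "n \<ge> 3"
  shows "word_class (dihedral_relations n) (refl_word i) \<notin> group_center (dihedral_group n)"
proof
  assume "word_class (dihedral_relations n) (refl_word i) \<in> group_center (dihedral_group n)"
  then have "[word_act (refl_word i) (word_act (rot_word 1) 0) =
      word_act (rot_word 1) (word_act (refl_word i) 0)] (mod int n)"
    using word_class_in_center_iff[OF n] by blast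
  then have "int n dvd 2"
    by (simp add: cong_iff_dvd_diff)
  then show False
    using n zdvd_imp_le by fastforce
qed

text \<open>
  Commuting with the reflection \<open>s\<close> forces \<open>i\<close> to be congruent to \<open>- i\<close>; conversely, adding such an
  \<open>i\<close> commutes with both generators.
\<close>

lemma rot_central_iff:
  assumes n: "n \<ge> 3"
  shows "word_class (dihedral_relations n) (rot_word i) \<in> group_center (dihedral_group n)
    \<longleftrightarrow> n dvd 2 * i"
proof
  assume "word_class (dihedral_relations n) (rot_word i) \<in> group_center (dihedral_group n)"
  then have "[word_act (rot_word i) (word_act (refl_word 0) 0) =
      word_act (refl_word 0) (word_act (rot_word i) 0)] (mod int n)"
    using word_class_in_center_iff[OF n] by blast
  then have "int n dvd 2 * int i"
    by (simp add: cong_iff_dvd_diff)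
  then show "n dvd 2 * i"
    by (simp flip: int_dvd_int_iff)
next
  assume "n dvd 2 * i"
  then have dvd: "int n dvd 2 * int i"
    by (simp flip: int_dvd_int_iff)
  have "[word_act v x + int i = word_act v (x + int i)] (mod int n)" for v x
  proof (induction v)
    case (Cons l v)
    have "[letter_act l y + int i = letter_act l (y + int i)] (mod int n)" for y
      using dvd by (cases "(l, y)" rule: letter_act.cases) (auto simp: cong_iff_dvd_diff algebra_simps)
    then show ?case
      using letter_act_cong[OF Cons.IH] cong_trans by (simp, blast)
  qed simp
  then show "word_class (dihedral_relations n) (rot_word i) \<in> group_center (dihedral_group n)"
    using word_class_in_center_iff[OF n] by simp
qed

lemma dvd_double_iff:
  assumes "1 \<le> i" "i \<le> (n::nat)"
  shows "n dvd 2 * i \<longleftrightarrow> i = n \<or> 2 * i = n"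
proof
  assume "n dvd 2 * i"
  then obtain k where k: "2 * i = n * k" by (elim dvdE)
  then have "k \<noteq> 0" using assms by (cases k) auto
  moreover have "k < 3"
  proof (rule ccontr)
    assume "\<not> k < 3"
    then have "n * 3 \<le> n * k" by simp
    then show False using k assms by linarith
  qed
  ultimately have "k = 1 \<or> k = 2" by auto
  then show "i = n \<or> 2 * i = n" using k by auto
qed auto

lemma card_dihedral_center:
  assumes n: "n \<ge> 3"
  shows "card (group_center (dihedral_group n)) = (if odd n then 1 else 2)"
proof -
  let ?rot = "\<lambda>i. word_class (dihedral_relations n) (rot_word i)"
  have "group_center (dihedral_group n) \<subseteq> ?rot ` {1..n}"
  proof
    fix z assume z: "z \<in> group_center (dihedral_group n)"
    then have "z \<in> carrier (dihedral_group n)"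
      by (simp add: group_center_def)
    then obtain w where w: "z = word_class (dihedral_relations n) w"
      by (auto simp: dihedral_carrier)
    obtain i where "i \<in> {1..n}" "z = ?rot i \<or> z = word_class (dihedral_relations n) (refl_word i)"
      using dihedral_normal_form[of n w] n unfolding w by auto
    then show "z \<in> ?rot ` {1..n}"
      using refl_not_central[OF n] z by blast
  qed
  then have "group_center (dihedral_group n) = ?rot ` {i \<in> {1..n}. n dvd 2 * i}"
    using rot_central_iff[OF n] by auto
  moreover have "inj_on ?rot {1..n}"
    unfolding inj_on_def word_class_eq_iff word_eq_iff_act_cong[OF n] normal_form_act_cong_iff(1)[OF n]
    using cong_imp_eq_atLeast1_atMost by auto
  ultimately have "card (group_center (dihedral_group n)) = card {i \<in> {1..n}. n dvd 2 * i}"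
    by (metis (no_types, lifting) card_image inj_on_subset mem_Collect_eq subsetI)
  also have "{i \<in> {1..n}. n dvd 2 * i} = (if odd n then {n} else {n div 2, n})"
    using n dvd_double_iff[of _ n] by (auto elim!: evenE)
  finally show ?thesis
    using n by auto
qed

section \<open>The detour polynomial of the dihedral group\<close>

lemma dihedral_Omega_decomposition:
  assumes n: "n \<ge> 3"
  shows "dihedral_Omega n = dihedral_Omega1 n \<union> dihedral_Omega2 n"
proof -
  have "dihedral_Omega2 n \<inter> group_center (dihedral_group n) = {}"
    using refl_not_central[OF n]
    by (auto simp: dihedral_Omega2_def dihedral_r_pow dihedral_s_mult_rot)
  moreover have "carrier (dihedral_group n) =
      {dihedral_r n [^]\<^bsub>dihedral_group n\<^esub> i | i::nat. 1 \<le> i \<and> i \<le> n} \<union> dihedral_Omega2 n"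
    using n by (intro dihedral_elements) simp
  ultimately show ?thesis
    unfolding dihedral_Omega_def dihedral_Omega1_def by blast
qed

lemma card_dihedral_Omega:
  assumes n: "n \<ge> 3"
  shows "card (dihedral_Omega n) = (if odd n then 2 * n - 1 else 2 * n - 2)"
proof -
  have sub: "group_center (dihedral_group n) \<subseteq> carrier (dihedral_group n)"
    by (auto simp: group_center_def)
  then have "card (dihedral_Omega n) =
      card (carrier (dihedral_group n)) - card (group_center (dihedral_group n))"
    unfolding dihedral_Omega_def using finite_subset[OF sub order_dihedral(1)[OF n]]
    by (intro card_Diff_subset)
  then show ?thesis
    by (simp add: order_dihedral(2)[OF n] card_dihedral_center[OF n])
qed

theorem theorem3p2:
  fixes n :: nat
  assumes "n \<ge> 3"
  shows "dihedral_Omega n = dihedral_Omega1 n \<union> dihedral_Omega2 n \<and>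
    detour_polynomial (noncommuting_graph (dihedral_group n) (dihedral_Omega n)) =
      (if odd n then monom (int ((n - 1) * (2 * n - 1))) (2 * n - 2)
       else monom (int ((n - 1) * (2 * n - 3))) (2 * n - 3))"
proof (rule conjI[OF dihedral_Omega_decomposition[OF assms]])
  let ?N = "card (dihedral_Omega n)"
  have poly: "detour_polynomial (noncommuting_graph (dihedral_group n) (dihedral_Omega n)) =
      monom (int (?N choose 2)) (?N - 1)"
    unfolding dihedral_Omega_def
    by (rule dihedral.detour_polynomial_noncommuting_graph[OF order_dihedral(1)[OF assms]])
  obtain m where m: "n = Suc m"
    using assms by (cases n) auto
  have "(2 * n - 1) choose 2 = (n - 1) * (2 * n - 1)" "(2 * n - 2) choose 2 = (n - 1) * (2 * n - 3)"
    by (simp_all add: choose_two m)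
  then show "detour_polynomial (noncommuting_graph (dihedral_group n) (dihedral_Omega n)) =
      (if odd n then monom (int ((n - 1) * (2 * n - 1))) (2 * n - 2)
       else monom (int ((n - 1) * (2 * n - 3))) (2 * n - 3))"
    unfolding poly card_dihedral_Omega[OF assms]
    by (simp add: diff_diff_left del: One_nat_def of_nat_mult)
qed

end
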